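(* There exists a countably infinite set $P$ of points in the Euclidean plane $\mathbb{R}^2$ such that no 4 points of $P$ are collinear and no 3 points of $P$ are pairwise visible with respect to $P$.
   Context: Let $P$ be a set of points in the plane. Two distinct points $v$ and $w$ in the plane are called visible with respect to $P$ if no point of $P$ lies in the open line segment $\overline{vw}$ (the segment between $v$ and $w$, excluding its endpoints). A set of points is pairwise visible if every two distinct points in it are visible with respect to $P$. *)

theory Defs
  imports "HOL-Analysis.Analysis"
begin

definition visible :: "(real^2) set \<Rightarrow> real^2 \<Rightarrow> real^2 \<Rightarrow> bool" where
  "visible P v w \<longleftrightarrow> v \<noteq> w \<and> P \<inter> open_segment v w = {}"

definition pairwise_visible :: "(real^2) set \<Rightarrow> (real^2) set \<Rightarrow> bool" where
  "pairwise_visible P S \<longleftrightarrow> pairwise (visible P) S"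

end

theory Submission
  imports Defs "HOL-Library.Nat_Bijection"
begin

text \<open>
  Build the points one at a time so that every new point lies on at most one line through two
  earlier points, and then strictly between these two. The last of any four collinear points would
  violate this, so no four points become collinear. Moreover, if three of the current points see
  each other, then for one of the two sides at the most recent vertex \<open>w\<close> the line through this side
  contains no third point: a third point later than \<open>w\<close> would block the side, and an earlier one
  makes the side span the unique old line on which \<open>w\<close> was placed. So a generic point on this side
  is a legal next point, and it destroys the visible triple. Every finite set of indices gets its
  turn; whenever there is nothing to destroy, a point in general position is added.
\<close>

text \<open>The last clause compares pairs of points and not the lines through them. Hence a line
  through \<open>y\<close> and two points of \<open>A\<close> contains no third point of
  \<open>A\<close>, which is what excludes four collinear points.\<close>

definition admissible :: "'a::euclidean_space set \<Rightarrow> 'a \<Rightarrow> bool" where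
  "admissible A y \<longleftrightarrow> y \<notin> A \<and>
    (\<forall>a\<in>A. \<forall>b\<in>A. a \<noteq> b \<and> collinear {a, b, y} \<longrightarrow> y \<in> open_segment a b \<and>
      (\<forall>c\<in>A. \<forall>d\<in>A. c \<noteq> d \<and> collinear {c, d, y} \<longrightarrow> {c, d} = {a, b}))"

lemma admissible_notin: "admissible A y \<Longrightarrow> y \<notin> A"
  unfolding admissible_def by (rule conjunct1)

lemma admissible_between:
  "admissible A y \<Longrightarrow> a \<in> A \<Longrightarrow> b \<in> A \<Longrightarrow> a \<noteq> b \<Longrightarrow> collinear {a, b, y} \<Longrightarrow> y \<in> open_segment a b"
  by (rule admissible_def[THEN iffD1, THEN conjunct2, rule_format, THEN conjunct1])
    (assumption | rule conjI)+

lemma admissible_unique: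
  "admissible A y \<Longrightarrow> a \<in> A \<Longrightarrow> b \<in> A \<Longrightarrow> a \<noteq> b \<Longrightarrow> collinear {a, b, y} \<Longrightarrow>
    c \<in> A \<Longrightarrow> d \<in> A \<Longrightarrow> c \<noteq> d \<Longrightarrow> collinear {c, d, y} \<Longrightarrow> {c, d} = {a, b}"
  by (rule admissible_def[THEN iffD1, THEN conjunct2, rule_format, THEN conjunct2, rule_format])
    (assumption | rule conjI)+

section \<open>Existence of admissible points\<close>

lemma collinear_open_segment:
  fixes a :: "'a::euclidean_space"
  assumes "y \<in> open_segment a b"
  shows "collinear {a, b, y}"
proof -
  have "between (a, b) y"
    using assms by (simp add: between_mem_segment open_segment_def)
  then have "collinear {a, y, b}"
    by (rule between_imp_collinear)
  then show ?thesis
    by (simp add: insert_commute)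
qed

text \<open>In dimension at least 2 a line is negligible, so \<open>A\<close> and the finitely many
  lines through two of its points cannot cover the space.\<close>

lemma ex_general_position:
  fixes A :: "'a::euclidean_space set"
  assumes "finite A" and dim: "2 \<le> DIM('a)"
  shows "\<exists>y. y \<notin> A \<and> (\<forall>a\<in>A. \<forall>b\<in>A. a \<noteq> b \<longrightarrow> \<not> collinear {a, b, y})"
proof -
  have neg: "negligible (affine hull {a, b})" for a b :: 'a
  proof -
    have "card {a, b} \<le> DIM('a)"
      using dim card_insert_le_m1[of 2 "{b}" a] by simp
    then have "interior (affine hull {a, b}) = {}"
      by (intro empty_interior_affine_hull) auto
    then show ?thesis
      by (simp add: negligible_convex_interior affine_imp_convex affine_affine_hull)
  qed
  have "negligible (A \<union> (\<Union>a\<in>A. \<Union>b\<in>A. affine hull {a, b}))"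
    using assms neg by (auto intro!: negligible_Un negligible_Union)
  then obtain y where y: "y \<notin> A \<union> (\<Union>a\<in>A. \<Union>b\<in>A. affine hull {a, b})"
    using non_negligible_UNIV by (metis UNIV_eq_I)
  have "\<not> collinear {a, b, y}" if "a \<in> A" "b \<in> A" "a \<noteq> b" for a b
    using y that by (auto simp: collinear_3_affine_hull)
  with y show ?thesis
    by blast
qed

lemma ex_admissible:
  fixes A :: "'a::euclidean_space set"
  assumes "finite A" "2 \<le> DIM('a)"
  shows "\<exists>y. admissible A y"
proof -
  obtain y where "y \<notin> A" "\<forall>a\<in>A. \<forall>b\<in>A. a \<noteq> b \<longrightarrow> \<not> collinear {a, b, y}"
    using ex_general_position[OF assms] by blast
  then have "admissible A y"
    unfolding admissible_def by (intro conjI ballI impI) blast+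
  then show ?thesis ..
qed

text \<open>Two common points of the lines would span both of them and so put \<open>a\<close>,
  \<open>b\<close>, \<open>c\<close>, \<open>d\<close> on one line. The intersection thus has at
  most one point.\<close>

lemma finite_collinear_inter:
  fixes a b c d :: "'a::euclidean_space"
  assumes "a \<noteq> b" "c \<noteq> d" "\<not> (collinear {a, b, c} \<and> collinear {a, b, d})"
  shows "finite {y. collinear {a, b, y} \<and> collinear {c, d, y}}"
proof -
  have "y = z" if "collinear {a, b, y}" "collinear {c, d, y}"
    "collinear {a, b, z}" "collinear {c, d, z}" for y z
  proof (rule ccontr)
    assume "y \<noteq> z"
    have "collinear {a, b, y, z}" "collinear {c, d, y, z}"
      using that assms by (simp_all add: collinear_4_3)
    then have "\<forall>t\<in>{a, b, c, d}. collinear {y, z, t}"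
      by (auto intro: collinear_subset)
    then have "collinear {y, z, a, b, c, d}"
      using collinear_triples[OF \<open>y \<noteq> z\<close>, of "{a, b, c, d}"] by simp
    then have "collinear {a, b, c}" "collinear {a, b, d}"
      by (auto elim!: collinear_subset)
    with assms show False
      by blast
  qed
  then obtain z where "{y. collinear {a, b, y} \<and> collinear {c, d, y}} \<subseteq> {z}"
    by blast
  then show ?thesis
    by (rule finite_subset) simp
qed

text \<open>By \<open>free\<close>, any other pair of points of \<open>A\<close> spans a line
  different from the one through \<open>a\<close> and \<open>b\<close>. These finitely many lines,
  together with \<open>A\<close>, exclude only finitely many points of the infinite open
  segment.\<close>

lemma ex_admissible_open_segment:
  fixes A :: "'a::euclidean_space set"
  assumes "finite A" and ab: "a \<in> A" "b \<in> A" "a \<noteq> b"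
    and free: "\<And>t. t \<in> A \<Longrightarrow> collinear {a, b, t} \<Longrightarrow> t = a \<or> t = b"
  shows "\<exists>y \<in> open_segment a b. admissible A y"
proof -
  define I where "I = {(c, d). c \<in> A \<and> d \<in> A \<and> c \<noteq> d \<and> {c, d} \<noteq> {a, b}}"
  define F where "F = A \<union> (\<Union>(c, d)\<in>I. {y. collinear {a, b, y} \<and> collinear {c, d, y}})"
  have "I \<subseteq> A \<times> A"
    by (auto simp: I_def)
  then have "finite I"
    using \<open>finite A\<close> by (meson finite_SigmaI finite_subset)
  moreover have "finite {y. collinear {a, b, y} \<and> collinear {c, d, y}}" if "(c, d) \<in> I" for c d
  proof (rule finite_collinear_inter)
    show "\<not> (collinear {a, b, c} \<and> collinear {a, b, d})"
      using that free[of c] free[of d] unfolding I_def by blast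
  qed (use that ab in \<open>auto simp: I_def\<close>)
  ultimately have "finite F"
    using \<open>finite A\<close> by (auto simp: F_def)
  moreover have "infinite (open_segment a b)"
    using ab by simp
  ultimately obtain y where y: "y \<in> open_segment a b" "y \<notin> F"
    by (meson finite_subset subsetI)
  have uniq: "{c, d} = {a, b}" if "c \<in> A" "d \<in> A" "c \<noteq> d" "collinear {c, d, y}" for c d
    using y that collinear_open_segment[OF y(1)] unfolding F_def I_def by blast
  have "y \<in> open_segment c d" if "c \<in> A" "d \<in> A" "c \<noteq> d" "collinear {c, d, y}" for c d
    using uniq[OF that] y(1) by (auto simp: doubleton_eq_iff open_segment_commute)
  moreover have "y \<notin> A"
    using y by (simp add: F_def)
  ultimately have "admissible A y"
    unfolding admissible_def using uniq by (metis (no_types))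
  with y show ?thesis
    by blast
qed

section \<open>Blocking a visible triple\<close>

lemma admissible_sequence_inj_on:
  fixes x :: "nat \<Rightarrow> 'a::euclidean_space"
  assumes "\<And>m. m \<in> M \<Longrightarrow> admissible (x ` {..<m}) (x m)"
  shows "inj_on x M"
proof (rule linorder_inj_onI)
  fix i j :: nat
  assume "i < j" "i \<in> M" "j \<in> M"
  then show "x i \<noteq> x j"
    using admissible_notin[OF assms[of j]] by (metis imageI lessThan_iff)
qed auto

text \<open>If both sides at \<open>x k\<close> had a third point on their lines, these points would
  be older than \<open>x k\<close>. Uniqueness for \<open>x k\<close> would then merge the two lines
  and place \<open>x k\<close> between \<open>x i\<close> and \<open>x j\<close>, which see each
  other.\<close>

lemma free_edge_at_last_vertex:
  fixes x :: "nat \<Rightarrow> real^2"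
  assumes adm: "\<And>m. m < n \<Longrightarrow> admissible (x ` {..<m}) (x m)"
    and ijk: "i < k" "j < k" "k < n" "i \<noteq> j"
    and vis: "pairwise_visible (x ` {..<n}) {x i, x j, x k}"
  shows "\<exists>l\<in>{i, j}. \<forall>t\<in>x ` {..<n}. collinear {x l, x k, t} \<longrightarrow> t = x l \<or> t = x k"
proof (rule ccontr)
  let ?P = "x ` {..<n}"
  assume "\<not> ?thesis"
  then obtain s t where s: "s < n" "x s \<noteq> x i" "x s \<noteq> x k" "collinear {x i, x k, x s}"
    and t: "t < n" "x t \<noteq> x j" "x t \<noteq> x k" "collinear {x j, x k, x t}"
    by auto
  have inj: "inj_on x {..<n}"
    using adm by (intro admissible_sequence_inj_on) auto
  then have ne: "x i \<noteq> x j" "x i \<noteq> x k" "x j \<noteq> x k"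
    using ijk by (auto dest: inj_onD)
  \<comment> \<open>A point placed after \<open>x k\<close> on the line of a side lies strictly
    inside that side by admissibility, so it would block a visible pair.\<close>
  have older: "r < k"
    if r: "r < n" "x r \<noteq> x l" "x r \<noteq> x k" "collinear {x l, x k, x r}" and l: "l \<in> {i, j}" for l r
  proof (rule ccontr)
    assume "\<not> r < k"
    with r have "k < r"
      by (metis linorder_neqE_nat)
    then have "x r \<in> open_segment (x l) (x k)"
      using ijk r l ne by (intro admissible_between[OF adm[of r]]) auto
    moreover have "visible ?P (x l) (x k)"
      using vis l ne unfolding pairwise_visible_def pairwise_def by blast
    ultimately show False
      using r unfolding visible_def by auto
  qed
  have "s < k" "t < k"
    using older[of s i] older[of t j] s t by auto
  moreover have c: "collinear {x i, x s, x k}" "collinear {x j, x t, x k}"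
    using s t by (auto simp: insert_commute)
  ultimately have "{x j, x t} = {x i, x s}"
    using ijk s t by (intro admissible_unique[OF adm[of k]]) auto
  \<comment> \<open>\<open>x j\<close> occurs in the pair \<open>{x i, x s}\<close> and differs from
    \<open>x i\<close>.\<close>
  then have "x s = x j"
    using ne by (auto simp: doubleton_eq_iff)
  then have "x k \<in> open_segment (x i) (x j)"
    using c ijk ne by (intro admissible_between[OF adm[of k]]) auto
  moreover have "visible ?P (x i) (x j)"
    using vis ne unfolding pairwise_visible_def pairwise_def by blast
  ultimately show False
    using ijk unfolding visible_def by auto
qed

text \<open>If the triple is already blocked, any admissible point will do, since adding points
  never restores visibility. Otherwise the new point goes on the free side at the vertex of largest
  index.\<close>

lemma ex_admissible_blocking:
  fixes x :: "nat \<Rightarrow> real^2"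
  assumes adm: "\<And>m. m < n \<Longrightarrow> admissible (x ` {..<m}) (x m)"
    and T: "T \<subseteq> {..<n}" "card T = 3"
  shows "\<exists>y. admissible (x ` {..<n}) y \<and> \<not> pairwise_visible (insert y (x ` {..<n})) (x ` T)"
proof (cases "pairwise_visible (x ` {..<n}) (x ` T)")
  case False
  obtain y where "admissible (x ` {..<n}) y"
    using ex_admissible[of "x ` {..<n}"] by auto
  moreover have "\<not> pairwise_visible (insert y (x ` {..<n})) (x ` T)"
    using False unfolding pairwise_visible_def pairwise_def visible_def by blast
  ultimately show ?thesis
    by blast
next
  case True
  have "finite T" "T \<noteq> {}"
    using T card.infinite by fastforce+
  define k where "k = Max T"
  have k: "k \<in> T" "\<And>i. i \<in> T \<Longrightarrow> i \<le> k"
    using \<open>finite T\<close> \<open>T \<noteq> {}\<close> by (auto simp: k_def)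
  have "card (T - {k}) = 2"
    using k T \<open>finite T\<close> by simp
  then obtain i j where ij: "T - {k} = {i, j}" "i \<noteq> j"
    by (auto simp: card_2_iff)
  then have "i \<in> T" "j \<in> T" "i \<noteq> k" "j \<noteq> k"
    by blast+
  then have lt: "i < k" "j < k" "k < n"
    using k T(1) by (auto simp: less_le)
  have "T = {i, j, k}"
    using ij k by blast
  then have xT: "x ` T = {x i, x j, x k}"
    by simp
  obtain l where l: "l \<in> {i, j}" "\<forall>t\<in>x ` {..<n}. collinear {x l, x k, t} \<longrightarrow> t = x l \<or> t = x k"
    using free_edge_at_last_vertex[OF adm lt ij(2)] True xT by auto
  have "inj_on x {..<n}"
    using adm by (intro admissible_sequence_inj_on) auto
  then have ne: "x l \<noteq> x k"
    using l(1) lt by (auto simp: inj_on_eq_iff)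
  then obtain y where y: "y \<in> open_segment (x l) (x k)" "admissible (x ` {..<n}) y"
    using ex_admissible_open_segment[of "x ` {..<n}" "x l" "x k"] l lt by auto
  have "\<not> visible (insert y (x ` {..<n})) (x l) (x k)"
    using y by (auto simp: visible_def)
  then have "\<not> pairwise_visible (insert y (x ` {..<n})) (x ` T)"
    using l ne unfolding xT pairwise_visible_def pairwise_def by blast
  with y show ?thesis
    by blast
qed

section \<open>The infinite sequence\<close>

lemma set_decode_subset_lessThan: "set_decode n \<subseteq> {..<n}"
proof
  fix k
  assume "k \<in> set_decode n"
  \<comment> \<open>The binary digit of \<open>n\<close> at place \<open>k\<close> is 1; combined
    with \<open>k < 2 ^ k\<close> this puts \<open>k\<close> below \<open>n\<close>.\<close>
  then have "2 ^ k \<le> n"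
    by (metis div_less even_zero not_le set_decode_def mem_Collect_eq)
  then show "k \<in> {..<n}"
    by (auto intro: order.strict_trans2[OF less_exp])
qed

text \<open>Stage \<open>n\<close> treats the index set with binary code \<open>n\<close>. Its
  elements are below \<open>n\<close>, so the points concerned have already been placed.\<close>

lemma ex_blocking_sequence:
  "\<exists>x :: nat \<Rightarrow> real^2. \<forall>n. admissible (x ` {..<n}) (x n) \<and>
    (card (set_decode n) = 3 \<longrightarrow>
      \<not> pairwise_visible (insert (x n) (x ` {..<n})) (x ` set_decode n))"
proof (rule dependent_wellorder_choice)
  fix y :: "real^2" and f g :: "nat \<Rightarrow> real^2" and n
  assume "\<And>m. m < n \<Longrightarrow> f m = g m"
  \<comment> \<open>The recursion principle requires that the condition at stage \<open>n\<close>
    depend only on earlier values.\<close>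
  then have "f ` {..<n} = g ` {..<n}" "f ` set_decode n = g ` set_decode n"
    using set_decode_subset_lessThan[of n] by (auto intro!: image_cong)
  then show "(admissible (f ` {..<n}) y \<and> (card (set_decode n) = 3 \<longrightarrow>
      \<not> pairwise_visible (insert y (f ` {..<n})) (f ` set_decode n))) =
    (admissible (g ` {..<n}) y \<and> (card (set_decode n) = 3 \<longrightarrow>
      \<not> pairwise_visible (insert y (g ` {..<n})) (g ` set_decode n)))"
    by simp
next
  fix n and x :: "nat \<Rightarrow> real^2"
  assume "\<And>m. m < n \<Longrightarrow> admissible (x ` {..<m}) (x m) \<and> (card (set_decode m) = 3 \<longrightarrow>
      \<not> pairwise_visible (insert (x m) (x ` {..<m})) (x ` set_decode m))"
  then show "\<exists>y. admissible (x ` {..<n}) y \<and> (card (set_decode n) = 3 \<longrightarrow>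
      \<not> pairwise_visible (insert y (x ` {..<n})) (x ` set_decode n))"
    using ex_admissible_blocking[of n x "set_decode n"] ex_admissible[of "x ` {..<n}"]
      set_decode_subset_lessThan[of n]
    by (cases "card (set_decode n) = 3") auto
qed

text \<open>The point of largest index would lie on a line that already contains three earlier
  points, so two different pairs of earlier points would span a line through it.\<close>

lemma admissible_sequence_not_collinear:
  fixes x :: "nat \<Rightarrow> 'a::euclidean_space"
  assumes adm: "\<And>m. admissible (x ` {..<m}) (x m)" and T: "card T = 4"
  shows "\<not> collinear (x ` T)"
proof
  assume col: "collinear (x ` T)"
  have "finite T" "T \<noteq> {}"
    using T card.infinite by fastforce+
  define m where "m = Max T"
  have m: "m \<in> T" "\<And>i. i \<in> T \<Longrightarrow> i \<le> m"
    using \<open>finite T\<close> \<open>T \<noteq> {}\<close> by (auto simp: m_def)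
  have "card (T - {m}) = 3"
    using m T \<open>finite T\<close> by simp
  then obtain a b c where abc: "T - {m} = {a, b, c}" "a \<noteq> b" "b \<noteq> c" "a \<noteq> c"
    by (auto simp: card_3_iff)
  then have T_eq: "T = {a, b, c, m}" and "m \<notin> {a, b, c}"
    using m by blast+
  then have lt: "a < m" "b < m" "c < m"
    using m(2) by (auto simp: less_le)
  have ne: "x a \<noteq> x b" "x b \<noteq> x c" "x a \<noteq> x c"
    using admissible_sequence_inj_on[of UNIV x] adm abc by (auto dest: injD)
  have "collinear {x a, x b, x m}" "collinear {x a, x c, x m}"
    using col T_eq by (auto intro: collinear_subset)
  then have "{x a, x c} = {x a, x b}"
    using lt ne by (intro admissible_unique[OF adm[of m]]) auto
  then show False
    using ne by (auto simp: doubleton_eq_iff)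
qed

theorem mainTheorem1:
  shows "\<exists>P :: (real^2) set. countable P \<and> infinite P
    \<and> (\<forall>S. S \<subseteq> P \<and> card S = 4 \<longrightarrow> \<not> collinear S)
    \<and> (\<forall>S. S \<subseteq> P \<and> card S = 3 \<longrightarrow> \<not> pairwise_visible P S)"
proof -
  obtain x :: "nat \<Rightarrow> real^2" where adm: "\<And>n. admissible (x ` {..<n}) (x n)"
    and block: "\<And>n. card (set_decode n) = 3 \<Longrightarrow>
      \<not> pairwise_visible (insert (x n) (x ` {..<n})) (x ` set_decode n)"
    using ex_blocking_sequence by blast
  have inj: "inj x"
    using adm by (rule admissible_sequence_inj_on)
  have preimage: "\<exists>T. S = x ` T \<and> card T = card S" if "S \<subseteq> range x" for S
    using that inj by (metis card_image inj_on_subset subset_imageE)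
  have "\<not> collinear S" if "S \<subseteq> range x" "card S = 4" for S
    using preimage[OF that(1)] that(2) admissible_sequence_not_collinear[OF adm] by auto
  moreover have "\<not> pairwise_visible (range x) S" if S: "S \<subseteq> range x" "card S = 3" for S
  proof -
    obtain T where T: "S = x ` T" "card T = 3"
      using preimage[OF S(1)] S(2) by auto
    then have "finite T"
      using card.infinite by fastforce
    \<comment> \<open>The triple is blocked at the latest at the stage whose number encodes
      \<open>T\<close>, and it stays blocked as further points are added.\<close>
    then have "\<not> pairwise_visible (insert (x (set_encode T)) (x ` {..<set_encode T})) S"
      using block[of "set_encode T"] T by (simp add: set_encode_inverse)
    moreover have "insert (x (set_encode T)) (x ` {..<set_encode T}) \<subseteq> range x"
      by auto
    ultimately show ?thesis
      unfolding pairwise_visible_def pairwise_def visible_def by blast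
  qed
  moreover have "countable (range x)" "infinite (range x)"
    using inj by (auto dest: finite_imageD)
  ultimately show ?thesis
    by blast
qed

end
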